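(* Let $S$ be a nonempty set, let $F$ be $\mathbb{Q}$, $\mathbb{R}$ or $\mathbb{C}$, let $B$ be a Banach space over $F$, and let $\rho:S\to S$, $p:S\to F\setminus\{0\}$, $q:S\to B$ and $\psi:S\to[0,\infty)$ be functions. Suppose there exists a real number $0<L<1$ such that $$\psi(\rho(x))\le L\,|p(\rho(x))|\,\psi(x)\quad\text{for all }x\in S.$$ Then for every function $f:S\to B$ satisfying $$\|f(\rho(x))-p(x)f(x)-q(x)\|\le\psi(x)\quad\text{for all }x\in S,$$ there exists a unique function $T:S\to B$ such that $$T(\rho(x))=p(x)T(x)+q(x)\quad\text{and}\quad \|f(x)-T(x)\|\le\frac{\psi(x)}{(1-L)|p(x)|}$$ for all $x\in S$.
   Context: A Banach space over $F$ is a complete normed vector space over $F$, with $F$ carrying the usual absolute value. *)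

theory Defs
  imports "HOL-Analysis.Analysis"
begin

(* The fields Q, R and C, each given with its embedding into the complex numbers.
   The axioms determine the field up to isomorphism as one of these three, and the
   usual absolute value is the one inherited from the complex numbers. *)
class rat_real_complex = field +
  fixes to_complex :: "'a \<Rightarrow> complex"
  assumes to_complex_one: "to_complex 1 = 1"
    and to_complex_add: "to_complex (a + b) = to_complex a + to_complex b"
    and to_complex_mult: "to_complex (a * b) = to_complex a * to_complex b"
    and range_to_complex: "range to_complex \<in> {\<rat>, \<real>, UNIV}"

definition field_abs :: "'a::rat_real_complex \<Rightarrow> real" where
  "field_abs a = cmod (to_complex a)"

instantiation rat :: rat_real_complex
begin
definition to_complex_rat :: "rat \<Rightarrow> complex" where "to_complex_rat = of_rat"
instance
  by standard (simp_all add: to_complex_rat_def of_rat_add of_rat_mult Rats_def)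
end

instantiation real :: rat_real_complex
begin
definition to_complex_real :: "real \<Rightarrow> complex" where "to_complex_real = of_real"
instance
  by standard (simp_all add: to_complex_real_def Reals_def)
end

instantiation complex :: rat_real_complex
begin
definition to_complex_complex :: "complex \<Rightarrow> complex" where "to_complex_complex = id"
instance
  by standard (simp_all add: to_complex_complex_def)
end

lemma field_abs_rat: "field_abs (a::rat) = real_of_rat \<bar>a\<bar>"
proof -
  have "(of_rat a :: complex) = of_real (of_rat a)"
    by (cases a) (simp add: of_rat_rat)
  then show ?thesis
    by (simp add: field_abs_def to_complex_rat_def abs_if of_rat_minus)
qed

lemma field_abs_real: "field_abs (a::real) = \<bar>a\<bar>"
  by (simp add: field_abs_def to_complex_real_def)

lemma field_abs_complex: "field_abs (a::complex) = cmod a"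
  by (simp add: field_abs_def to_complex_complex_def)

(* The library classes for normed spaces only cover real scalars. *)
locale normed_space_over =
  vector_space scale
  for scale :: "'k::rat_real_complex \<Rightarrow> 'b::ab_group_add \<Rightarrow> 'b" +
  fixes nrm :: "'b \<Rightarrow> real"
  assumes nrm_nonneg: "0 \<le> nrm x"
    and nrm_eq_0_iff: "nrm x = 0 \<longleftrightarrow> x = 0"
    and nrm_scale: "nrm (scale a x) = field_abs a * nrm x"
    and nrm_triangle: "nrm (x + y) \<le> nrm x + nrm y"
begin

lemma nrm_minus: "nrm (- x) = nrm x"
proof -
  have "to_complex (0 + 0 :: 'k) = to_complex (0::'k) + to_complex (0::'k)"
    by (rule to_complex_add)
  then have "to_complex (0::'k) = 0"
    by simp
  moreover have "to_complex (1 + - 1 :: 'k) = to_complex (1::'k) + to_complex (- 1 :: 'k)"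
    by (rule to_complex_add)
  ultimately have "to_complex (- 1 :: 'k) = - 1"
    by (simp add: to_complex_one eq_neg_iff_add_eq_0 add.commute)
  then show ?thesis
    using nrm_scale[of "- 1" x] by (simp add: field_abs_def)
qed

sublocale metric: Metric_space UNIV "\<lambda>x y. nrm (x - y)"
proof
  show "nrm (x - y) = nrm (y - x)" for x y
    using nrm_minus[of "x - y"] by simp
  show "nrm (x - z) \<le> nrm (x - y) + nrm (y - z)" for x y z
    using nrm_triangle[of "x - y" "y - z"] by simp
qed (simp_all add: nrm_nonneg nrm_eq_0_iff)

end

locale banach_space_over = normed_space_over +
  assumes complete: "metric.mcomplete"

lemma banach_space_over_real:
  "banach_space_over (scaleR :: real \<Rightarrow> 'b \<Rightarrow> 'b::banach) norm"
proof -
  interpret normed_space_over "scaleR :: real \<Rightarrow> 'b \<Rightarrow> 'b" norm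
    by unfold_locales (simp_all add: field_abs_real algebra_simps norm_triangle_ineq)
  have "(\<lambda>x y::'b. norm (x - y)) = dist"
    by (simp add: fun_eq_iff dist_norm)
  then have "metric.mcomplete"
    using mcomplete_iff_complete complete_UNIV[where ?'a='b] by simp
  then show ?thesis
    by unfold_locales
qed

end

theory Submission
  imports Defs
begin

text \<open>
  The functional equation says that \<open>T\<close> is a fixed point of
  \<open>(A g) x = (g (\<rho> x) - q x) / p x\<close>. The hypothesis on \<open>\<psi>\<close> makes \<open>A\<close> a contraction
  with factor \<open>L\<close> for the weighted sup norm with weight \<open>K x = \<psi> x / \<bar>p x\<bar>\<close>, and \<open>f\<close> has
  distance at most 1 from \<open>A f\<close>. The iterates of \<open>A\<close> at \<open>f\<close> therefore stay within
  \<open>1 / (1 - L)\<close> of \<open>f\<close> and converge pointwise to the fixed point.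
\<close>

lemma field_abs_mult: "field_abs (a * b) = field_abs a * field_abs b"
  by (simp add: field_abs_def to_complex_mult norm_mult)

lemma field_abs_one: "field_abs 1 = 1"
  by (simp add: field_abs_def to_complex_one)

text \<open>The product with the value at \<open>inverse a\<close> is 1, so the value at
  \<open>a\<close> cannot vanish; injectivity of \<open>to_complex\<close> need not be
  derived.\<close>

lemma field_abs_pos:
  assumes "a \<noteq> 0"
  shows "0 < field_abs a"
proof -
  have "field_abs a * field_abs (inverse a) = 1"
    using assms by (simp flip: field_abs_mult add: field_abs_one)
  then show ?thesis
    by (metis field_abs_def mult_zero_left norm_ge_zero order_le_less zero_neq_one)
qed

text \<open>Applied with \<open>a\<close> the norm of a difference, this turns a geometric bound
  into equality of two vectors.\<close>

lemma le_geometric_imp_le_0: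
  fixes a c r :: real
  assumes "0 \<le> r" "r < 1" and le: "\<And>n. a \<le> r ^ n * c"
  shows "a \<le> 0"
proof (rule LIMSEQ_le_const)
  show "(\<lambda>n. r ^ n * c) \<longlonglongrightarrow> 0"
    using tendsto_mult_left_zero[OF LIMSEQ_power_zero[of r]] assms by simp
qed (use le in auto)

lemma (in normed_space_over) nrm_scale_inverse:
  assumes "a \<noteq> 0"
  shows "nrm (scale (inverse a) v) = nrm v / field_abs a"
proof -
  have "field_abs a * nrm (scale (inverse a) v) = nrm v"
    using assms by (simp flip: nrm_scale)
  then show ?thesis
    using field_abs_pos[OF assms] by (simp add: field_simps)
qed

text \<open>The bound is uniform in \<open>k\<close>, so \<open>s\<close> is Cauchy, and letting
  \<open>k\<close> tend to infinity carries the same bound over to the limit.\<close>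

lemma (in banach_space_over) geometric_limit:
  fixes s :: "nat \<Rightarrow> 'b"
  assumes r: "0 \<le> r" "r < 1"
    and le: "\<And>n k. nrm (s n - s (n + k)) \<le> r ^ n * c"
  obtains l where "\<And>n. nrm (s n - l) \<le> r ^ n * c"
proof -
  have lim: "(\<lambda>n. r ^ n * c) \<longlonglongrightarrow> 0"
    using tendsto_mult_left_zero[OF LIMSEQ_power_zero[of r]] r by simp
  have "metric.MCauchy s"
    unfolding metric.MCauchy_def
  proof (intro conjI allI impI)
    fix e :: real
    assume "e > 0"
    with lim obtain N where N: "\<And>n. n \<ge> N \<Longrightarrow> r ^ n * c < e"
      by (metis (no_types, lifting) eventually_sequentially order_tendstoD(2))
    have less: "nrm (s m - s n) < e" if "N \<le> m" "m \<le> n" for m n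
      using le[of m "n - m"] N[of m] that by simp
    show "\<exists>N. \<forall>n n'. N \<le> n \<longrightarrow> N \<le> n' \<longrightarrow> nrm (s n - s n') < e"
      using less metric.commute by (metis nle_le)
  qed simp
  then obtain l where l: "limitin metric.mtopology s l sequentially"
    using complete by (auto simp: metric.mcomplete_def)
  have "nrm (s n - l) \<le> r ^ n * c" for n
  proof (rule field_le_epsilon)
    fix e :: real
    assume "e > 0"
    with l obtain N where N: "\<And>m. m \<ge> N \<Longrightarrow> nrm (s m - l) < e"
      unfolding metric.limit_metric_sequentially by blast
    \<comment> \<open>The index \<open>n + N\<close> has the form required by \<open>le\<close> and
      is also at least \<open>N\<close>.\<close>
    have "nrm (s n - l) \<le> nrm (s n - s (n + N)) + nrm (s (n + N) - l)"
      using metric.triangle by simp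
    then show "nrm (s n - l) \<le> r ^ n * c + e"
      using le[of n N] N[of "n + N"] by simp
  qed
  then show thesis
    by (rule that)
qed

theorem theorem5p1:
  fixes scale :: "'k::rat_real_complex \<Rightarrow> 'b::ab_group_add \<Rightarrow> 'b"
    and nrm :: "'b \<Rightarrow> real"
    and \<rho> :: "'s \<Rightarrow> 's"
    and p :: "'s \<Rightarrow> 'k"
    and q :: "'s \<Rightarrow> 'b"
    and \<psi> :: "'s \<Rightarrow> real"
    and L :: real
  assumes "banach_space_over scale nrm"
    and "\<And>x. p x \<noteq> 0"
    and "\<And>x. 0 \<le> \<psi> x"
    and "0 < L" and "L < 1"
    and "\<And>x. \<psi> (\<rho> x) \<le> L * field_abs (p (\<rho> x)) * \<psi> x"
  shows "\<forall>f :: 's \<Rightarrow> 'b.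
    (\<forall>x. nrm (f (\<rho> x) - scale (p x) (f x) - q x) \<le> \<psi> x) \<longrightarrow>
    (\<exists>!T :: 's \<Rightarrow> 'b. \<forall>x.
       T (\<rho> x) = scale (p x) (T x) + q x \<and>
       nrm (f x - T x) \<le> \<psi> x / ((1 - L) * field_abs (p x)))"
proof (intro allI impI)
  interpret banach_space_over scale nrm
    by fact
  note pos = field_abs_pos[OF assms(2)]
  fix f :: "'s \<Rightarrow> 'b"
  assume f: "\<forall>x. nrm (f (\<rho> x) - scale (p x) (f x) - q x) \<le> \<psi> x"
  define A where "A g x = scale (inverse (p x)) (g (\<rho> x) - q x)" for g :: "'s \<Rightarrow> 'b" and x
  define K where "K x = \<psi> x / field_abs (p x)" for x
  have K_nonneg: "0 \<le> K x" for x
    using assms(3) pos[of x] by (simp add: K_def)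
  \<comment> \<open>This is the growth hypothesis on \<psi>, divided by the absolute values of
    \<open>p (\<rho> x)\<close> and \<open>p x\<close>.\<close>
  have K_step: "K (\<rho> x) / field_abs (p x) \<le> L * K x" for x
    using assms(6)[of x] pos[of x] pos[of "\<rho> x"] by (simp add: K_def field_simps)
  have bound_eq: "\<psi> x / ((1 - L) * field_abs (p x)) = 1 / (1 - L) * K x" for x
    by (simp add: K_def)
  have fix_iff: "T (\<rho> x) = scale (p x) (T x) + q x \<longleftrightarrow> A T x = T x" for T x
  proof
    assume "A T x = T x"
    then have "scale (p x) (T x) = T (\<rho> x) - q x"
      using assms(2)[of x] by (simp flip: \<open>A T x = T x\<close> add: A_def)
    then show "T (\<rho> x) = scale (p x) (T x) + q x"
      by simp
  qed (use assms(2) in \<open>simp add: A_def\<close>)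
  \<comment> \<open>The weighted norm appears only through admissible constants \<open>c\<close>:
    \<open>K\<close> may vanish at some points, and the weighted distance of two arbitrary functions
    may be infinite.\<close>
  have contraction: "nrm (A g x - A h x) \<le> L * c * K x"
    if "0 \<le> c" and gh: "\<And>x. nrm (g x - h x) \<le> c * K x" for g h c x
  proof -
    have "A g x - A h x = scale (inverse (p x)) (g (\<rho> x) - h (\<rho> x))"
      by (simp add: A_def flip: scale_right_diff_distrib)
    then have "nrm (A g x - A h x) = nrm (g (\<rho> x) - h (\<rho> x)) / field_abs (p x)"
      using assms(2) by (simp add: nrm_scale_inverse)
    also have "\<dots> \<le> c * K (\<rho> x) / field_abs (p x)"
      using gh pos[of x] by (intro divide_right_mono) auto
    also have "\<dots> \<le> L * c * K x"
      using mult_left_mono[OF K_step \<open>0 \<le> c\<close>] by (simp add: mult_ac)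
    finally show ?thesis .
  qed
  have iterate: "nrm ((A ^^ n) g x - (A ^^ n) h x) \<le> L ^ n * c * K x"
    if "0 \<le> c" and "\<And>x. nrm (g x - h x) \<le> c * K x" for g h c n x
  proof (induction n arbitrary: x)
    case (Suc n)
    then show ?case
      using contraction[of "L ^ n * c"] \<open>0 \<le> c\<close> \<open>0 < L\<close> by (simp add: mult_ac)
  qed (use that in simp)
  have start: "nrm (f x - A f x) \<le> K x" for x
  proof -
    have "A f x - f x = scale (inverse (p x)) (f (\<rho> x) - scale (p x) (f x) - q x)"
      using assms(2) by (simp add: A_def scale_right_diff_distrib)
    then have "nrm (A f x - f x) = nrm (f (\<rho> x) - scale (p x) (f x) - q x) / field_abs (p x)"
      using assms(2) by (simp add: nrm_scale_inverse)
    also have "\<dots> \<le> K x"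
      using f pos[of x] by (simp add: K_def divide_right_mono)
    finally show ?thesis
      by (simp add: metric.commute)
  qed
  \<comment> \<open>The constant \<open>1 / (1 - L)\<close> solves \<open>c = 1 + L * c\<close>, so
    the induction reproduces it exactly.\<close>
  have near: "nrm (f x - (A ^^ n) f x) \<le> 1 / (1 - L) * K x" for n x
  proof (induction n arbitrary: x)
    case 0
    then show ?case
      using K_nonneg \<open>L < 1\<close> metric.mdist_zero by simp
  next
    case (Suc n)
    have "nrm (f x - (A ^^ Suc n) f x) \<le> nrm (f x - A f x) + nrm (A f x - A ((A ^^ n) f) x)"
      using metric.triangle by simp
    also have "\<dots> \<le> K x + L * (1 / (1 - L)) * K x"
      using Suc.IH \<open>L < 1\<close> by (intro add_mono start contraction) auto
    also have "\<dots> = 1 / (1 - L) * K x"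
      using \<open>L < 1\<close> by (simp add: field_simps)
    finally show ?case .
  qed
  have "\<exists>l. \<forall>n. nrm ((A ^^ n) f x - l) \<le> L ^ n * (1 / (1 - L) * K x)" for x
  proof -
    \<comment> \<open>Apply the \<open>n\<close>-th iterate to the pair \<open>f\<close> and
      \<open>(A ^^ k) f\<close>, whose weighted distance is bounded independently of
      \<open>k\<close>.\<close>
    have "nrm ((A ^^ n) f x - (A ^^ (n + k)) f x) \<le> L ^ n * (1 / (1 - L) * K x)" for n k
      using iterate[of "1 / (1 - L)" f "(A ^^ k) f" n x] near \<open>L < 1\<close>
      by (simp add: funpow_add)
    then show ?thesis
      using geometric_limit[of L "\<lambda>n. (A ^^ n) f x"] \<open>0 < L\<close> \<open>L < 1\<close> by (metis less_imp_le)
  qed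
  then obtain T where T: "\<And>n x. nrm ((A ^^ n) f x - T x) \<le> L ^ n * (1 / (1 - L) * K x)"
    by metis
  have "A T x = T x" for x
  proof -
    \<comment> \<open>Iterate \<open>n + 1\<close> lies within
      \<open>L ^ (n + 1) / (1 - L) * K x\<close> of \<open>A T x\<close>, by contraction, and of
      \<open>T x\<close>, by the choice of \<open>T\<close>; hence the factor 2 and the extra
      \<open>L\<close>.\<close>
    have "nrm (A T x - T x) \<le> L ^ n * (L * (2 * (1 / (1 - L) * K x)))" for n
    proof -
      have "nrm (A ((A ^^ n) f) x - A T x) \<le> L * (L ^ n * (1 / (1 - L))) * K x"
        using T \<open>0 < L\<close> \<open>L < 1\<close> by (intro contraction) (auto simp: mult_ac)
      then have "nrm (A ((A ^^ n) f) x - A T x) \<le> L ^ Suc n * (1 / (1 - L) * K x)"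
        by (simp add: mult_ac)
      moreover have "nrm (A T x - T x)
          \<le> nrm (A ((A ^^ n) f) x - A T x) + nrm (A ((A ^^ n) f) x - T x)"
        using metric.triangle[of "A T x" "A ((A ^^ n) f) x" "T x"] metric.commute[of "A T x"] by simp
      ultimately have "nrm (A T x - T x) \<le> 2 * (L ^ Suc n * (1 / (1 - L) * K x))"
        using T[of "Suc n" x] by simp
      then show ?thesis
        by (simp add: mult_ac)
    qed
    then have "nrm (A T x - T x) \<le> 0"
      by (rule le_geometric_imp_le_0[OF less_imp_le[OF \<open>0 < L\<close>] \<open>L < 1\<close>])
    then show ?thesis
      using nrm_nonneg[of "A T x - T x"] nrm_eq_0_iff[of "A T x - T x"] by simp
  qed
  moreover have "nrm (f x - T x) \<le> 1 / (1 - L) * K x" for x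
    using T[of 0 x] by simp
  moreover have "T' = T''"
    if T': "\<And>x. A T' x = T' x" "\<And>x. nrm (f x - T' x) \<le> 1 / (1 - L) * K x"
      and T'': "\<And>x. A T'' x = T'' x" "\<And>x. nrm (f x - T'' x) \<le> 1 / (1 - L) * K x" for T' T''
  proof
    fix x
    \<comment> \<open>Passing through \<open>f\<close> makes the weighted distance of the two
      solutions finite. Iterating \<open>A\<close> fixes both solutions but shrinks this bound by
      \<open>L ^ n\<close>.\<close>
    have "nrm (T' x - T'' x) \<le> 2 / (1 - L) * K x" for x
      using metric.triangle[of "T' x" "f x" "T'' x"] metric.commute[of "T' x" "f x"]
        T'(2)[of x] T''(2)[of x] by simp
    then have "nrm ((A ^^ n) T' x - (A ^^ n) T'' x) \<le> L ^ n * (2 / (1 - L)) * K x" for n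
      using \<open>L < 1\<close> by (intro iterate) auto
    moreover have "A T' = T'" "A T'' = T''"
      using T'(1) T''(1) by auto
    then have "(A ^^ n) T' = T'" "(A ^^ n) T'' = T''" for n
      by (induction n) auto
    ultimately have "nrm (T' x - T'' x) \<le> L ^ n * (2 / (1 - L) * K x)" for n
      by (simp add: mult.assoc)
    then have "nrm (T' x - T'' x) \<le> 0"
      by (rule le_geometric_imp_le_0[OF less_imp_le[OF \<open>0 < L\<close>] \<open>L < 1\<close>])
    then show "T' x = T'' x"
      using nrm_nonneg[of "T' x - T'' x"] nrm_eq_0_iff[of "T' x - T'' x"] by simp
  qed
  ultimately show "\<exists>!T. \<forall>x. T (\<rho> x) = scale (p x) (T x) + q x \<and>
      nrm (f x - T x) \<le> \<psi> x / ((1 - L) * field_abs (p x))"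
    unfolding fix_iff bound_eq by (intro ex1I[of _ T]) blast+
qed

end
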